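(* Let $(Y_t)_{t\ge1}$ be a $\{0,1\}$-valued sequence of random variables such that $\mathsf{E}[Y_t\mid Y^{t-1}]\equiv\mu$ for every $t\ge 1$ and some $\mu\in(0,1)$. (a) For any $\delta\in(0,1]$, $$\mathsf{P}\Bigl\{\sup_{t\ge1}\tilde\phi_t\Bigl(\sum_{i=1}^tY_i;\frac1\mu,\frac1{1-\mu}\Bigr)\ge\frac1\delta\Bigr\}\le\delta.$$ (b) For any $t\ge 1$ and $x\in[0,t]$, the function $m\mapsto\tilde\phi_t(x;\frac1m,\frac1{1-m})$ is log-convex, and thus for any $\delta\in(0,1)$ and $y^t\in\{0,1\}^t$ the set $$\mathcal{C}_t^\pi(y^t)=\Bigl\{m\in[0,1]:\ \sup_{1\le i\le t}\tilde\phi_i\Bigl(\sum_{j=1}^iy_j;\frac1m,\frac1{1-m}\Bigr)<\frac1\delta\Bigr\}$$ is an interval $(\mu_t^{\mathrm{low}}(y^t;\delta),\mu_t^{\mathrm{up}}(y^t;\delta))\subseteq[0,1]$. Therefore, equivalently, for any $\delta\in(0,1)$, $$\mathsf{P}\bigl\{\exists t\ge1:\ \mu\notin(\mu_t^{\mathrm{low}}(Y^t;\delta),\mu_t^{\mathrm{up}}(Y^t;\delta))\bigr\}\le\delta.$$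
   Context: $Y^t=(Y_1,\dots,Y_t)$. For $t\ge1$, $x\in[0,t]$ and $o_1,o_2>0$, $\tilde\phi_t(x;o_1,o_2)=o_1^xo_2^{t-x}\,B(x+\frac12,t-x+\frac12)/B(\frac12,\frac12)$, where $B$ is the beta function. A positive function $f$ is log-convex if $\log f$ is convex. Thus $\tilde\phi_t(x;\frac1m,\frac1{1-m})=m^{-x}(1-m)^{-(t-x)}B(x+\frac12,t-x+\frac12)/B(\frac12,\frac12)$; at $m\in\{0,1\}$ it is interpreted in $(0,\infty]$ with $0^0=1$ and $1/0=\infty$. The interval may be empty; $(\mu_t^{\mathrm{low}},\mu_t^{\mathrm{up}})$ denotes the open interval between the infimum and supremum of the set (the empty interval if the set is empty), and it may differ from the set only in the boundary points $0,1$ of $[0,1]$. *)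

theory Defs
  imports "HOL-Probability.Probability"
begin

text \<open>Powers \<open>a\<^sup>x\<close> for \<open>x \<ge> 0\<close> and \<open>a \<in> [0,\<infinity>]\<close>, with \<open>a\<^sup>0 = 1\<close> for every \<open>a\<close> (including
  \<open>\<infinity>\<close>) and \<open>\<infinity>\<^sup>x = \<infinity>\<close> for \<open>x > 0\<close>.\<close>

definition epow :: "ennreal \<Rightarrow> real \<Rightarrow> ennreal" where
  "epow a x = (if x = 0 then 1 else if a = \<top> then \<top> else ennreal (enn2real a powr x))"

text \<open>The odds \<open>o1\<close>, \<open>o2\<close> are extended so that \<open>o1 = 1/m\<close>, \<open>o2 = 1/(1 - m)\<close> make sense at
  \<open>m = 0\<close> and \<open>m = 1\<close>; in \<^typ>\<open>ennreal\<close>, \<open>1/0 = \<infinity>\<close>. No product \<open>0 * \<infinity>\<close> occurs for these odds,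
  because both are at least 1. For finite positive odds see \<open>phi_ennreal\<close> below.\<close>

definition phi :: "nat \<Rightarrow> real \<Rightarrow> ennreal \<Rightarrow> ennreal \<Rightarrow> ennreal" where
  "phi t x o1 o2 = epow o1 x * epow o2 (real t - x) *
     ennreal (Beta (x + 1/2) (real t - x + 1/2) / Beta (1/2) (1/2))"

definition eln :: "ennreal \<Rightarrow> ereal" where
  "eln a = (if a = 0 then - \<infinity> else if a = \<top> then \<infinity> else ereal (ln (enn2real a)))"

text \<open>Log-convexity for \<open>(0,\<infinity>]\<close>-valued functions. Positivity keeps \<open>-\<infinity>\<close> out of the sum on the
  right, and \<open>0 * \<infinity> = 0\<close> in \<^typ>\<open>ereal\<close>. For finite functions see
  \<open>log_convex_on_ennreal_iff\<close> below.\<close>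

definition log_convex_on :: "real set \<Rightarrow> (real \<Rightarrow> ennreal) \<Rightarrow> bool" where
  "log_convex_on S f \<longleftrightarrow> convex S \<and> (\<forall>a\<in>S. 0 < f a) \<and>
     (\<forall>a\<in>S. \<forall>b\<in>S. \<forall>u\<ge>0. \<forall>v\<ge>0. u + v = 1 \<longrightarrow>
        eln (f (u * a + v * b)) \<le> ereal u * eln (f a) + ereal v * eln (f b))"

definition conf_set :: "nat \<Rightarrow> (nat \<Rightarrow> real) \<Rightarrow> real \<Rightarrow> real set" where
  "conf_set t y \<delta> = {m \<in> {0..1}.
     (SUP i\<in>{1..t}. phi i (\<Sum>j=1..i. y j) (1 / ennreal m) (1 / ennreal (1 - m)))
       < ennreal (1 / \<delta>)}"

text \<open>Infimum and supremum are taken in \<open>[0,1]\<close>, where \<open>inf {} = 1\<close> and \<open>sup {} = 0\<close>; hence the open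
  interval between them is empty if the confidence set is.\<close>

definition mu_low :: "nat \<Rightarrow> (nat \<Rightarrow> real) \<Rightarrow> real \<Rightarrow> real" where
  "mu_low t y \<delta> = (if conf_set t y \<delta> = {} then 1 else Inf (conf_set t y \<delta>))"

definition mu_up :: "nat \<Rightarrow> (nat \<Rightarrow> real) \<Rightarrow> real \<Rightarrow> real" where
  "mu_up t y \<delta> = (if conf_set t y \<delta> = {} then 0 else Sup (conf_set t y \<delta>))"

text \<open>The sigma-algebra \<open>\<sigma>(Y\<^sub>1, \<dots>, Y\<^sub>t\<^sub>-\<^sub>1)\<close>, trivial for \<open>t = 1\<close>.\<close>

definition past :: "'a measure \<Rightarrow> (nat \<Rightarrow> 'a \<Rightarrow> real) \<Rightarrow> nat \<Rightarrow> 'a measure" where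
  "past M Y t = vimage_algebra (space M) (\<lambda>\<omega>. \<lambda>s\<in>{1..<t}. Y s \<omega>) (\<Pi>\<^sub>M s\<in>{1..<t}. borel)"

lemma Beta_half_pos:
  assumes "0 \<le> x" "x \<le> real t"
  shows "0 < Beta (x + 1/2) (real t - x + 1/2) / Beta (1/2) (1/2 :: real)"
proof -
  have "0 < Beta (x + 1/2) (real t - x + 1/2)" "0 < Beta (1/2) (1/2 :: real)"
    using assms unfolding Beta_def
    by (intro divide_pos_pos mult_pos_pos Gamma_real_pos; simp)+
  then show ?thesis by simp
qed

lemma phi_ennreal:
  assumes "0 < o1" "0 < o2" "0 \<le> x" "x \<le> real t"
  shows "phi t x (ennreal o1) (ennreal o2) =
    ennreal (o1 powr x * o2 powr (real t - x) *
      (Beta (x + 1/2) (real t - x + 1/2) / Beta (1/2) (1/2)))"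
proof -
  have "epow (ennreal o1) x = ennreal (o1 powr x)"
    "epow (ennreal o2) (real t - x) = ennreal (o2 powr (real t - x))"
    using assms by (auto simp: epow_def)
  then show ?thesis
    unfolding phi_def using Beta_half_pos[OF assms(3,4)]
    by (simp only: ennreal_mult'' powr_ge_zero mult_nonneg_nonneg less_imp_le)
qed

lemma log_convex_on_ennreal_iff:
  assumes "\<And>a. a \<in> S \<Longrightarrow> 0 < f a"
  shows "log_convex_on S (\<lambda>a. ennreal (f a)) \<longleftrightarrow> convex_on S (\<lambda>a. ln (f a))"
proof -
  have eln: "eln (ennreal (f a)) = ereal (ln (f a))" if "a \<in> S" for a
    using assms[OF that] by (simp add: eln_def)
  have "u * a + v * b \<in> S"
    if "convex S" "a \<in> S" "b \<in> S" "0 \<le> u" "0 \<le> v" "u + v = 1" for a b u v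
    using convexD[OF that] by simp
  then show ?thesis
    using assms unfolding log_convex_on_def convex_on_def
    by (auto simp: eln)
qed

end

theory Submission
  imports Defs
begin

text \<open>
  The identity \<open>B(a + 1, b) + B(a, b + 1) = B(a, b)\<close> makes the wealth
  \<open>\<phi>\<^sub>t(Y\<^sub>1 + \<dots> + Y\<^sub>t; 1/\<mu>, 1/(1-\<mu>))\<close> a nonnegative martingale with initial value 1, since the
  increment of the wealth is a function of the past times \<open>Y\<^sub>t - \<mu>\<close>; Ville's inequality gives (a).
  For (b), the logarithm of the wealth is \<open>- x ln m - (t - x) ln (1 - m)\<close> plus a constant, which is
  convex in \<open>m\<close>, so the confidence set is an intersection of convex sublevel sets. The wealth is
  continuous on \<open>(0,1)\<close>, so the confidence set is open there and an interior point of \<open>[0,1]\<close> belongs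
  to it exactly when it lies strictly between its infimum and supremum.
\<close>

section \<open>Ville's inequality\<close>

text \<open>Induction on \<open>t\<close>. Keeping the integral over paths still below
  \<open>c\<close> as a second term on the left makes the bound inductive: the supermartingale
  inequality on that event passes from time \<open>t\<close> to \<open>Suc t\<close>, and paths that
  cross there are charged \<open>c\<close>. Adaptedness for all \<open>s \<le> t\<close> stands in
  for monotonicity of \<open>F\<close>; it puts the event of no crossing up to \<open>t\<close> into
  \<open>F t\<close>.\<close>

lemma (in finite_measure) ville_inequality_finite:
  fixes W :: "nat \<Rightarrow> 'a \<Rightarrow> real"
  assumes sub: "\<And>t. subalgebra M (F t)"
    and adapted: "\<And>s t. s \<le> t \<Longrightarrow> W s \<in> borel_measurable (F t)"
    and int: "\<And>t. integrable M (W t)"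
    and super: "\<And>t A. A \<in> sets (F t) \<Longrightarrow>
      (LINT \<omega>|M. indicator A \<omega> * W (Suc t) \<omega>) \<le> (LINT \<omega>|M. indicator A \<omega> * W t \<omega>)"
  shows "c * measure M {\<omega> \<in> space M. \<exists>s\<le>t. c \<le> W s \<omega>} +
    (LINT \<omega>|M. indicator {\<omega> \<in> space M. \<forall>s\<le>t. W s \<omega> < c} \<omega> * W t \<omega>) \<le> (LINT \<omega>|M. W 0 \<omega>)"
proof -
  define G where "G t = {\<omega> \<in> space M. \<forall>s\<le>t. W s \<omega> < c}" for t
  define H where "H t = {\<omega> \<in> space M. \<exists>s\<le>t. c \<le> W s \<omega>}" for t
  have spF: "space (F t) = space M" for t
    using sub by (simp add: subalgebra_def)
  have GF: "G t \<in> sets (F t)" for t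
  proof -
    have "{\<omega> \<in> space (F t). W s \<omega> < c} \<in> sets (F t)" if "s \<le> t" for s
      using adapted[OF that] by measurable
    then have "{\<omega> \<in> space (F t). \<forall>s\<in>{..t}. W s \<omega> < c} \<in> sets (F t)"
      by (rule sets.sets_Collect_finite_All) auto
    also have "{\<omega> \<in> space (F t). \<forall>s\<in>{..t}. W s \<omega> < c} = G t"
      by (auto simp: G_def spF)
    finally show ?thesis .
  qed
  have [measurable]: "G t \<in> sets M" for t
    using GF[of t] sub[of t] by (auto simp: subalgebra_def)
  have Heq: "H t = space M - G t" for t
    by (auto simp: H_def G_def not_less)
  have [measurable]: "H t \<in> sets M" for t
    unfolding Heq by measurable
  have [measurable]: "W t \<in> borel_measurable M" for t
    using int[of t] by measurable
  have iG: "integrable M (\<lambda>\<omega>. indicator (G s) \<omega> * W t \<omega>)" for s t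
    using integrable_mult_indicator[OF _ int[of t], of "G s"] by simp
  have iI: "integrable M (indicator A :: 'a \<Rightarrow> real)" if "A \<in> sets M" for A
    using that by (simp add: integrable_indicator_iff emeasure_eq_measure)
  have mI: "(LINT \<omega>|M. indicator A \<omega> :: real) = measure M A" if "A \<in> sets M" for A
    using that by (simp add: Int_absorb2 sets.sets_into_space)
  have "c * measure M (H t) + (LINT \<omega>|M. indicator (G t) \<omega> * W t \<omega>) \<le> (LINT \<omega>|M. W 0 \<omega>)"
  proof (induction t)
    case 0
    have "c * measure M (H 0) + (LINT \<omega>|M. indicator (G 0) \<omega> * W 0 \<omega>)
      = (LINT \<omega>|M. c * indicator (H 0) \<omega> + indicator (G 0) \<omega> * W 0 \<omega>)"
      by (subst Bochner_Integration.integral_add) (auto intro!: iI iG simp: mI)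
    also have "\<dots> \<le> (LINT \<omega>|M. W 0 \<omega>)"
    proof (rule integral_mono)
      show "integrable M (\<lambda>\<omega>. c * indicator (H 0) \<omega> + indicator (G 0) \<omega> * W 0 \<omega>)"
        by (intro Bochner_Integration.integrable_add iG integrable_mult_right iI) measurable
    qed (auto simp: H_def G_def int indicator_def)
    finally show ?case .
  next
    case (Suc t)
    \<comment> \<open>\<open>?D\<close> collects the paths whose first crossing is at
      \<open>Suc t\<close>. Together with \<open>G (Suc t)\<close> it partitions \<open>G t\<close>,
      and \<open>c \<le> W (Suc t)\<close> holds on it.\<close>
    let ?D = "H (Suc t) - H t"
    have "c * measure M ?D + (LINT \<omega>|M. indicator (G (Suc t)) \<omega> * W (Suc t) \<omega>)
      = (LINT \<omega>|M. c * indicator ?D \<omega> + indicator (G (Suc t)) \<omega> * W (Suc t) \<omega>)"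
      by (subst Bochner_Integration.integral_add) (auto intro!: iI iG simp: mI)
    also have "\<dots> \<le> (LINT \<omega>|M. indicator (G t) \<omega> * W (Suc t) \<omega>)"
    proof (rule integral_mono)
      show "integrable M (\<lambda>\<omega>. c * indicator ?D \<omega> + indicator (G (Suc t)) \<omega> * W (Suc t) \<omega>)"
        by (intro Bochner_Integration.integrable_add iG integrable_mult_right iI) measurable
    next
      fix \<omega> assume "\<omega> \<in> space M"
      then show "c * indicator ?D \<omega> + indicator (G (Suc t)) \<omega> * W (Suc t) \<omega>
        \<le> indicator (G t) \<omega> * W (Suc t) \<omega>"
        by (auto simp: H_def G_def indicator_def le_Suc_eq not_less all_conj_distrib)
    qed (rule iG)
    also have "\<dots> \<le> (LINT \<omega>|M. indicator (G t) \<omega> * W t \<omega>)"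
      by (rule super[OF GF])
    finally have "c * measure M ?D + (LINT \<omega>|M. indicator (G (Suc t)) \<omega> * W (Suc t) \<omega>)
      \<le> (LINT \<omega>|M. indicator (G t) \<omega> * W t \<omega>)" .
    moreover have "measure M ?D = measure M (H (Suc t)) - measure M (H t)"
      by (rule finite_measure_Diff) (auto simp: H_def intro: le_SucI)
    ultimately show ?case
      using Suc.IH by (simp add: algebra_simps)
  qed
  then show ?thesis
    by (simp add: G_def H_def)
qed

text \<open>Nonnegativity lets the integral over the uncrossed paths be dropped from the
  finite-horizon bound. The crossing events increase with the horizon, so continuity from below
  gives the bound for their union.\<close>

lemma (in finite_measure) ville_inequality:
  fixes W :: "nat \<Rightarrow> 'a \<Rightarrow> real"
  assumes sub: "\<And>t. subalgebra M (F t)"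
    and adapted: "\<And>s t. s \<le> t \<Longrightarrow> W s \<in> borel_measurable (F t)"
    and int: "\<And>t. integrable M (W t)"
    and nonneg: "\<And>t \<omega>. \<omega> \<in> space M \<Longrightarrow> 0 \<le> W t \<omega>"
    and super: "\<And>t A. A \<in> sets (F t) \<Longrightarrow>
      (LINT \<omega>|M. indicator A \<omega> * W (Suc t) \<omega>) \<le> (LINT \<omega>|M. indicator A \<omega> * W t \<omega>)"
    and c: "0 < c"
  shows "measure M {\<omega> \<in> space M. \<exists>t. c \<le> W t \<omega>} \<le> (LINT \<omega>|M. W 0 \<omega>) / c"
proof -
  define H where "H t = {\<omega> \<in> space M. \<exists>s\<le>t. c \<le> W s \<omega>}" for t
  have [measurable]: "W t \<in> borel_measurable M" for t
    using int[of t] by measurable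
  have H_sets: "H t \<in> sets M" for t
  proof -
    have "{\<omega> \<in> space M. \<exists>s\<in>{..t}. c \<le> W s \<omega>} \<in> sets M"
      by measurable
    then show ?thesis by (simp add: H_def Bex_def)
  qed
  have le: "measure M (H t) \<le> (LINT \<omega>|M. W 0 \<omega>) / c" for t
  proof -
    have "0 \<le> (LINT \<omega>|M. indicator {\<omega> \<in> space M. \<forall>s\<le>t. W s \<omega> < c} \<omega> * W t \<omega>)"
      by (rule Bochner_Integration.integral_nonneg) (simp add: nonneg)
    with ville_inequality_finite[of F W c t, OF sub adapted int super]
    have "c * measure M (H t) \<le> (LINT \<omega>|M. W 0 \<omega>)"
      by (simp add: H_def)
    then show ?thesis
      using c by (simp add: pos_le_divide_eq mult.commute)
  qed
  have "(\<lambda>t. measure M (H t)) \<longlonglongrightarrow> measure M (\<Union>t. H t)"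
    by (rule finite_Lim_measure_incseq)
      (auto simp: H_sets incseq_def H_def intro: order_trans)
  then have "measure M (\<Union>t. H t) \<le> (LINT \<omega>|M. W 0 \<omega>) / c"
    by (rule LIMSEQ_le_const2) (auto intro: le)
  also have "(\<Union>t. H t) = {\<omega> \<in> space M. \<exists>t. c \<le> W t \<omega>}"
    by (auto simp: H_def)
  finally show ?thesis .
qed

text \<open>A supremum can equal \<open>c\<close> although no single \<open>W t\<close> reaches
  \<open>c\<close>. Every level \<open>d < c\<close> is reached, however, so the bound at level
  \<open>d\<close> applies, and \<open>d\<close> then tends to \<open>c\<close> from below.\<close>

lemma (in finite_measure) ville_inequality_SUP:
  fixes W :: "nat \<Rightarrow> 'a \<Rightarrow> real"
  assumes sub: "\<And>t. subalgebra M (F t)"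
    and adapted: "\<And>s t. s \<le> t \<Longrightarrow> W s \<in> borel_measurable (F t)"
    and int: "\<And>t. integrable M (W t)"
    and nonneg: "\<And>t \<omega>. \<omega> \<in> space M \<Longrightarrow> 0 \<le> W t \<omega>"
    and super: "\<And>t A. A \<in> sets (F t) \<Longrightarrow>
      (LINT \<omega>|M. indicator A \<omega> * W (Suc t) \<omega>) \<le> (LINT \<omega>|M. indicator A \<omega> * W t \<omega>)"
    and c: "0 < c"
  shows "measure M {\<omega> \<in> space M. ennreal c \<le> (SUP t. ennreal (W t \<omega>))} \<le> (LINT \<omega>|M. W 0 \<omega>) / c"
    (is "measure M ?E \<le> ?I / c")
proof -
  have [measurable]: "W t \<in> borel_measurable M" for t
    using int[of t] by measurable
  have le: "measure M ?E \<le> ?I / d" if d: "0 < d" "d < c" for d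
  proof -
    have "?E \<subseteq> {\<omega> \<in> space M. \<exists>t. d \<le> W t \<omega>}"
    proof clarsimp
      fix \<omega> assume \<omega>: "\<omega> \<in> space M" "ennreal c \<le> (SUP t. ennreal (W t \<omega>))"
      have "ennreal d < ennreal c"
        using d by (simp add: ennreal_less_iff)
      with \<omega>(2) have "ennreal d < (SUP t. ennreal (W t \<omega>))"
        by (rule less_le_trans[rotated])
      then obtain t where "ennreal d < ennreal (W t \<omega>)"
        by (auto simp: less_SUP_iff)
      then show "\<exists>t. d \<le> W t \<omega>"
        using d by (auto simp: ennreal_less_iff intro: less_imp_le)
    qed
    then have "measure M ?E \<le> measure M {\<omega> \<in> space M. \<exists>t. d \<le> W t \<omega>}"
      by (rule finite_measure_mono) measurable
    also have "\<dots> \<le> ?I / d"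
      by (rule ville_inequality[of F W d, OF sub adapted int nonneg super d(1)])
    finally show ?thesis .
  qed
  have "((\<lambda>d. ?I / d) \<longlongrightarrow> ?I / c) (at_left c)"
    using c by (intro tendsto_intros) auto
  then show ?thesis
  proof (rule tendsto_lowerbound)
    show "\<forall>\<^sub>F d in at_left c. measure M ?E \<le> ?I / d"
      using eventually_at_left_real[OF c] by eventually_elim (auto intro: le)
  qed simp
qed

section \<open>The beta mixture process\<close>

text \<open>For \<open>0 < m < 1\<close> this is the likelihood ratio of a Bernoulli model mixed
  over the Beta(1/2, 1/2) prior (the Krichevsky-Trofimov mixture) against
  Bernoulli(\<open>m\<close>), after \<open>x\<close> ones in \<open>t\<close> trials. It is the
  real-valued form of \<open>phi\<close> at these odds.\<close>

definition beta_mix :: "real \<Rightarrow> nat \<Rightarrow> real \<Rightarrow> real" where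
  "beta_mix m t x = (1 / m) powr x * (1 / (1 - m)) powr (real t - x) *
     (Beta (x + 1/2) (real t - x + 1/2) / Beta (1/2) (1/2))"

lemma beta_mix_pos:
  assumes "0 < m" "m < 1" "0 \<le> x" "x \<le> real t"
  shows "0 < beta_mix m t x"
  unfolding beta_mix_def using assms
  by (intro mult_pos_pos Beta_half_pos) auto

lemma beta_mix_0 [simp]: "0 < m \<Longrightarrow> m < 1 \<Longrightarrow> beta_mix m 0 0 = 1"
  using Beta_half_pos[of 0 0] by (simp add: beta_mix_def split: if_splits)

text \<open>The fair-game property: the weights \<open>m\<close> and \<open>1 - m\<close> cancel one
  power of the matching odds, and the two remaining Beta values add up to the old one.\<close>

lemma beta_mix_average:
  assumes "0 < m" "m < 1" "0 \<le> x" "x \<le> real t"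
  shows "m * beta_mix m (Suc t) (x + 1) + (1 - m) * beta_mix m (Suc t) x = beta_mix m t x"
proof -
  have 1: "m * (1 / m) powr (x + 1) = (1 / m) powr x"
    using assms by (simp add: powr_add)
  have "real (Suc t) - x = (real t - x) + 1"
    by simp
  then have 2: "(1 - m) * (1 / (1 - m)) powr (real (Suc t) - x) = (1 / (1 - m)) powr (real t - x)"
    using assms by (simp only: powr_add) simp
  have 3: "Beta (x + 1 + 1/2) (real t - x + 1/2) + Beta (x + 1/2) (real (Suc t) - x + 1/2)
    = Beta (x + 1/2) (real t - x + 1/2)"
  proof -
    have "x + 1/2 \<notin> \<int>\<^sub>\<le>\<^sub>0" "real t - x + 1/2 \<notin> \<int>\<^sub>\<le>\<^sub>0"
      using assms by (auto simp: nonpos_Ints_altdef)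
    from Beta_plus1_plus1[OF this] show ?thesis
      by (simp add: algebra_simps)
  qed
  have "m * beta_mix m (Suc t) (x + 1) + (1 - m) * beta_mix m (Suc t) x
    = (m * (1 / m) powr (x + 1)) * (1 / (1 - m)) powr (real t - x) *
        (Beta (x + 1 + 1/2) (real t - x + 1/2) / Beta (1/2) (1/2))
    + (1 / m) powr x * ((1 - m) * (1 / (1 - m)) powr (real (Suc t) - x)) *
        (Beta (x + 1/2) (real (Suc t) - x + 1/2) / Beta (1/2) (1/2))"
    by (simp add: beta_mix_def mult.assoc mult.left_commute)
  also have "\<dots> = (1 / m) powr x * (1 / (1 - m)) powr (real t - x) *
     ((Beta (x + 1 + 1/2) (real t - x + 1/2) + Beta (x + 1/2) (real (Suc t) - x + 1/2))
       / Beta (1/2) (1/2))"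
    unfolding 1 2 by (simp add: distrib_left add_divide_distrib)
  also have "\<dots> = beta_mix m t x"
    unfolding 3 by (simp add: beta_mix_def)
  finally show ?thesis .
qed

text \<open>A function of \<open>y\<close> in {0, 1} is the restriction of an affine one. By the
  averaging identity its affine extension takes the value \<open>beta_mix m t x\<close> at
  \<open>y = m\<close>, and its slope is the difference of the two outcomes.\<close>

lemma beta_mix_step:
  assumes "0 < m" "m < 1" "0 \<le> x" "x \<le> real t" "y \<in> {0, 1}"
  shows "beta_mix m (Suc t) (x + y) = beta_mix m t x +
    (beta_mix m (Suc t) (x + 1) - beta_mix m (Suc t) x) * (y - m)"
  using assms(5) beta_mix_average[OF assms(1-4), symmetric] by (auto simp: algebra_simps)

section \<open>The observation filtration and functions of binary data\<close>

lemma subalgebra_past: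
  assumes "\<And>t. 1 \<le> t \<Longrightarrow> Y t \<in> borel_measurable M"
  shows "subalgebra M (past M Y t)"
proof -
  have "(\<lambda>\<omega>. \<lambda>s\<in>{1..<t}. Y s \<omega>) \<in> measurable M (\<Pi>\<^sub>M s\<in>{1..<t}. borel)"
    by (rule measurable_restrict) (use assms in auto)
  then show ?thesis
    by (auto simp: subalgebra_def past_def measurable_iff_sets)
qed

lemma measurable_past:
  assumes "1 \<le> s" "s < t"
  shows "Y s \<in> borel_measurable (past M Y t)"
proof -
  have "(\<lambda>\<omega>. \<lambda>s\<in>{1..<t}. Y s \<omega>) \<in> measurable (past M Y t) (\<Pi>\<^sub>M s\<in>{1..<t}. borel)"
    unfolding past_def by (rule measurable_vimage_algebra1) (auto simp: space_PiM)
  from measurable_compose[OF this measurable_component_singleton[of s]] show ?thesis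
    using assms by simp
qed

lemma partial_sum_bounds:
  fixes y :: "nat \<Rightarrow> real"
  assumes "\<forall>j\<in>{1..t}. y j \<in> {0, 1}" "i \<le> t"
  shows "0 \<le> (\<Sum>j=1..i. y j)" "(\<Sum>j=1..i. y j) \<le> real i"
proof -
  have Y01: "0 \<le> y j" "y j \<le> 1" if "j \<in> {1..i}" for j
    using assms(1)[rule_format, of j] assms(2) that by auto
  show "0 \<le> (\<Sum>j=1..i. y j)"
    by (intro sum_nonneg Y01)
  have "(\<Sum>j=1..i. y j) \<le> real (card {1..i}) * 1"
    by (intro sum_bounded_above Y01)
  then show "(\<Sum>j=1..i. y j) \<le> real i" by simp
qed

text \<open>Simple functions stay simple under composition with arbitrary functions. Measurability
  and integrability of the wealth therefore follow from the data being binary, without any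
  regularity of \<open>Beta\<close> in its arguments.\<close>

lemma simple_function_binary:
  fixes f :: "'a \<Rightarrow> real"
  assumes "f \<in> borel_measurable N" "\<And>\<omega>. \<omega> \<in> space N \<Longrightarrow> f \<omega> \<in> {0, 1}"
  shows "simple_function N f"
proof (rule simple_function_borel_measurable[OF assms(1)])
  have "f ` space N \<subseteq> {0, 1}"
    using assms(2) by auto
  then show "finite (f ` space N)"
    by (rule finite_subset) simp
qed

lemma (in finite_measure) integrable_finite_range:
  fixes f :: "'a \<Rightarrow> real"
  assumes "simple_function M f"
  shows "integrable M f"
proof -
  have "finite (f ` space M)"
    using assms by (rule simple_functionD)
  then have "bounded (f ` space M)"
    by (rule finite_imp_bounded)
  then obtain B where "\<forall>y\<in>f ` space M. norm y \<le> B"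
    by (auto simp: bounded_iff)
  then show ?thesis
    using assms by (intro integrable_const_bound[of _ B])
      (auto intro!: AE_I2 borel_measurable_simple_function)
qed

text \<open>Ville's inequality for the wealth started at time 0. The work lies in the martingale
  property, checked in integrated form over events of the past.\<close>

lemma (in prob_space) beta_mix_ville:
  fixes Y :: "nat \<Rightarrow> 'a \<Rightarrow> real"
  assumes meas: "\<And>t. 1 \<le> t \<Longrightarrow> Y t \<in> borel_measurable M"
    and bin: "\<And>t \<omega>. 1 \<le> t \<Longrightarrow> \<omega> \<in> space M \<Longrightarrow> Y t \<omega> \<in> {0, 1}"
    and \<mu>: "0 < \<mu>" "\<mu> < 1"
    and cexp: "\<And>t. 1 \<le> t \<Longrightarrow> AE \<omega> in M. real_cond_exp M (past M Y t) (Y t) \<omega> = \<mu>"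
    and c: "0 < c"
  shows "measure M {\<omega> \<in> space M. ennreal c \<le>
    (SUP t. ennreal (beta_mix \<mu> t (\<Sum>i=1..t. Y i \<omega>)))} \<le> 1 / c"
proof -
  define S where "S t \<omega> = (\<Sum>i=1..t. Y i \<omega>)" for t \<omega>
  have S_Suc: "S (Suc t) \<omega> = S t \<omega> + Y (Suc t) \<omega>" for t \<omega>
    by (simp add: S_def)
  have S_bounds: "0 \<le> S t \<omega>" "S t \<omega> \<le> real t" if "\<omega> \<in> space M" for t \<omega>
    using partial_sum_bounds[of t "\<lambda>i. Y i \<omega>" t] bin that by (auto simp: S_def)
  \<comment> \<open>\<open>past M Y t\<close> stops before time \<open>t\<close>, so the shift gives
    the sigma-algebra of the first \<open>t\<close> observations.\<close>
  define F where "F t = past M Y (Suc t)" for t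
  have sub: "subalgebra M (F t)" for t
    unfolding F_def using meas by (rule subalgebra_past)
  have space_F: "space (F t) = space M" for t
    using sub by (simp add: subalgebra_def)
  have simple_Y: "simple_function N (Y i)"
    if "Y i \<in> borel_measurable N" "space N = space M" "1 \<le> i" for i and N :: "'a measure"
    using that(1) by (rule simple_function_binary) (use bin that in auto)
  have simple_S: "simple_function (F t) (S s)" if "s \<le> t" for s t
    unfolding S_def[abs_def]
  proof (rule simple_function_sum, rule simple_Y)
    fix i assume "i \<in> {1..s}"
    with that show "Y i \<in> borel_measurable (F t)" "1 \<le> i"
      by (auto simp: F_def intro: measurable_past)
  qed (rule space_F)
  have simple_M: "simple_function M f" if "simple_function (F t) f" for t and f :: "'a \<Rightarrow> real"
    using that sub[of t] by (auto simp: simple_function_def subalgebra_def)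
  have int: "integrable M f" if "simple_function (F t) f" for t and f :: "'a \<Rightarrow> real"
    using that by (intro integrable_finite_range simple_M)
  have "measure M {\<omega> \<in> space M. ennreal c \<le> (SUP t. ennreal (beta_mix \<mu> t (S t \<omega>)))}
    \<le> (LINT \<omega>|M. beta_mix \<mu> 0 (S 0 \<omega>)) / c"
  proof (rule ville_inequality_SUP[OF sub _ _ _ _ c])
    show "(\<lambda>\<omega>. beta_mix \<mu> s (S s \<omega>)) \<in> borel_measurable (F t)" if "s \<le> t" for s t
      by (rule borel_measurable_simple_function[OF simple_function_compose1[OF simple_S[OF that]]])
    show "integrable M (\<lambda>\<omega>. beta_mix \<mu> t (S t \<omega>))" for t
      by (rule int[OF simple_function_compose1[OF simple_S[OF order_refl]]])
    show "0 \<le> beta_mix \<mu> t (S t \<omega>)" if "\<omega> \<in> space M" for t \<omega>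
      by (intro less_imp_le beta_mix_pos \<mu> S_bounds that)
  next
    fix t A assume A: "A \<in> sets (F t)"
    \<comment> \<open>The slope from \<open>beta_mix_step\<close>, restricted to \<open>A\<close>:
      the stake on the next outcome, which depends only on the past.\<close>
    define f where "f \<omega> = indicator A \<omega> *
      (beta_mix \<mu> (Suc t) (S t \<omega> + 1) - beta_mix \<mu> (Suc t) (S t \<omega>))" for \<omega>
    have simple_A: "simple_function (F t) (indicator A :: 'a \<Rightarrow> real)"
      using A by (rule simple_function_indicator)
    have simple_f: "simple_function (F t) f"
      unfolding f_def[abs_def]
      by (rule simple_function_mult[OF simple_A simple_function_compose1[OF simple_S[OF order_refl]]])
    have int_fY: "integrable M (\<lambda>\<omega>. f \<omega> * Y (Suc t) \<omega>)"
      by (rule integrable_finite_range[OF simple_function_mult[OF simple_M[OF simple_f]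
            simple_Y[OF meas refl]]]) auto
    interpret sub: finite_measure_subalgebra M "F t"
      by unfold_locales (rule sub)
    \<comment> \<open>Since \<open>f\<close> is measurable for \<open>F t\<close>, the next outcome
      may be replaced by its conditional expectation, which is \<open>\<mu>\<close> almost
      everywhere.\<close>
    have "(LINT \<omega>|M. f \<omega> * Y (Suc t) \<omega>)
      = (LINT \<omega>|M. f \<omega> * real_cond_exp M (F t) (Y (Suc t)) \<omega>)"
      by (rule sub.real_cond_exp_intg(2)[symmetric, OF int_fY
            borel_measurable_simple_function[OF simple_f] meas]) simp
    also have "\<dots> = (LINT \<omega>|M. f \<omega> * \<mu>)"
    proof (rule integral_cong_AE)
      show "AE \<omega> in M. f \<omega> * real_cond_exp M (F t) (Y (Suc t)) \<omega> = f \<omega> * \<mu>"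
        using cexp[of "Suc t"] by (auto simp: F_def)
      have [measurable]: "f \<in> borel_measurable M"
        using simple_M[OF simple_f] by (rule borel_measurable_simple_function)
      show "(\<lambda>\<omega>. f \<omega> * real_cond_exp M (F t) (Y (Suc t)) \<omega>) \<in> borel_measurable M"
        using borel_measurable_cond_exp2[of M "F t" "Y (Suc t)"] by measurable
      show "(\<lambda>\<omega>. f \<omega> * \<mu>) \<in> borel_measurable M"
        by measurable
    qed
    finally have orth: "(LINT \<omega>|M. f \<omega> * Y (Suc t) \<omega>) = (LINT \<omega>|M. f \<omega> * \<mu>)" .
    have int_AW: "integrable M (\<lambda>\<omega>. indicator A \<omega> * beta_mix \<mu> t (S t \<omega>))"
      by (rule int[OF simple_function_mult[OF simple_A simple_function_compose1[OF simple_S[OF order_refl]]]])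
    have int_f\<mu>: "integrable M (\<lambda>\<omega>. f \<omega> * \<mu>)"
      using int[OF simple_f] by simp
    have "(LINT \<omega>|M. indicator A \<omega> * beta_mix \<mu> (Suc t) (S (Suc t) \<omega>))
      = (LINT \<omega>|M. indicator A \<omega> * beta_mix \<mu> t (S t \<omega>) + (f \<omega> * Y (Suc t) \<omega> - f \<omega> * \<mu>))"
    proof (rule Bochner_Integration.integral_cong[OF refl])
      fix \<omega> assume \<omega>: "\<omega> \<in> space M"
      have "Y (Suc t) \<omega> \<in> {0, 1}"
        by (rule bin) (use \<omega> in auto)
      note step = beta_mix_step[OF \<mu> S_bounds[OF \<omega>, of t] this]
      show "indicator A \<omega> * beta_mix \<mu> (Suc t) (S (Suc t) \<omega>)
        = indicator A \<omega> * beta_mix \<mu> t (S t \<omega>) + (f \<omega> * Y (Suc t) \<omega> - f \<omega> * \<mu>)"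
        unfolding S_Suc step f_def by (simp add: algebra_simps)
    qed
    also have "\<dots> = (LINT \<omega>|M. indicator A \<omega> * beta_mix \<mu> t (S t \<omega>))"
      using int_AW int_fY int_f\<mu> orth by simp
    finally show "(LINT \<omega>|M. indicator A \<omega> * beta_mix \<mu> (Suc t) (S (Suc t) \<omega>))
      \<le> (LINT \<omega>|M. indicator A \<omega> * beta_mix \<mu> t (S t \<omega>))"
      by simp
  qed
  also have "(LINT \<omega>|M. beta_mix \<mu> 0 (S 0 \<omega>)) = 1"
    using \<mu> by (simp add: S_def prob_space)
  finally show ?thesis
    by (simp add: S_def)
qed

section \<open>Log-convexity and confidence sets\<close>

text \<open>For \<open>x = 0\<close> the exponential branch gives 1 also at \<open>m = 0\<close>,
  whatever \<open>ln 0\<close> is; this is the convention for the zeroth power.\<close>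

lemma epow_inverse:
  assumes "0 \<le> m" "0 \<le> x"
  shows "epow (1 / ennreal m) x =
    (if 0 < x \<and> m = 0 then \<top> else ennreal (exp (- (x * ln m))))"
proof (cases "m = 0")
  case False
  then have "1 / ennreal m = ennreal (1 / m)"
    using assms divide_ennreal[of 1 m] by simp
  then show ?thesis
    using False assms by (simp add: epow_def powr_def ln_div)
qed (use assms in \<open>auto simp: epow_def\<close>)

text \<open>Separates the poles at the two ends of the unit interval from the finite values. All
  factors are positive, so one infinite factor makes the whole product infinite. The exponential
  form displays the logarithm needed for convexity.\<close>

lemma phi_odds:
  assumes "0 \<le> m" "m \<le> 1" "0 \<le> x" "x \<le> real t"
  shows "phi t x (1 / ennreal m) (1 / ennreal (1 - m)) =
    (if 0 < x \<and> m = 0 \<or> x < real t \<and> m = 1 then \<top>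
     else ennreal (exp (- (x * ln m) - (real t - x) * ln (1 - m)) *
       (Beta (x + 1/2) (real t - x + 1/2) / Beta (1/2) (1/2))))"
proof -
  define C where "C = Beta (x + 1/2) (real t - x + 1/2) / Beta (1/2) (1/2 :: real)"
  have C: "0 < C"
    unfolding C_def by (rule Beta_half_pos) (use assms in auto)
  have "phi t x (1 / ennreal m) (1 / ennreal (1 - m)) =
    (if 0 < x \<and> m = 0 then \<top> else ennreal (exp (- (x * ln m)))) *
    (if x < real t \<and> m = 1 then \<top> else ennreal (exp (- ((real t - x) * ln (1 - m))))) * ennreal C"
    using assms by (simp add: phi_def epow_inverse C_def)
  also have "\<dots> = (if 0 < x \<and> m = 0 \<or> x < real t \<and> m = 1 then \<top>
     else ennreal (exp (- (x * ln m) - (real t - x) * ln (1 - m)) * C))"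
    using C by (auto simp: ennreal_mult_top ennreal_top_mult exp_diff exp_minus divide_inverse
        simp flip: ennreal_mult)
  finally show ?thesis
    by (simp add: C_def)
qed

lemma eln_top [simp]: "eln \<top> = \<infinity>"
  by (simp add: eln_def)

lemma eln_ennreal: "0 < r \<Longrightarrow> eln (ennreal r) = ereal (ln r)"
  by (simp add: eln_def)

lemma mult_ln_concave:
  fixes x a b u v :: real
  assumes "0 \<le> x" "0 \<le> a" "0 \<le> b" "0 < u" "0 < v" "u + v = 1"
    and "0 < x \<Longrightarrow> a \<noteq> 0" "0 < x \<Longrightarrow> b \<noteq> 0"
  shows "u * (x * ln a) + v * (x * ln b) \<le> x * ln (u * a + v * b)"
proof (cases "x = 0")
  case False
  with assms have ab: "0 < a" "0 < b" "0 < x"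
    by (auto simp: less_le)
  have "u * ln a + v * ln b \<le> ln (u * a + v * b)"
  proof -
    have u: "u = 1 - v"
      using \<open>u + v = 1\<close> by simp
    show ?thesis
      using concave_onD[OF ln_concave, of v a b] ab \<open>0 < u\<close> \<open>0 < v\<close> unfolding u by simp
  qed
  from mult_left_mono[OF this, of x] show ?thesis
    using ab by (simp add: algebra_simps)
qed simp

text \<open>Away from the poles the logarithm is a constant plus nonnegative multiples of
  \<open>- ln m\<close> and \<open>- ln (1 - m)\<close>, both convex. A pole carrying positive
  weight makes the right side infinite.\<close>

lemma log_convex_on_phi:
  assumes "0 \<le> x" "x \<le> real t"
  shows "log_convex_on {0..1} (\<lambda>m. phi t x (1 / ennreal m) (1 / ennreal (1 - m)))"
    (is "log_convex_on _ ?f")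
proof -
  define C where "C = Beta (x + 1/2) (real t - x + 1/2) / Beta (1/2) (1/2 :: real)"
  have C: "0 < C"
    unfolding C_def by (rule Beta_half_pos) (use assms in auto)
  define pole where "pole m \<longleftrightarrow> 0 < x \<and> m = 0 \<or> x < real t \<and> m = 1" for m :: real
  have f: "?f m = (if pole m then \<top> else
      ennreal (exp (- (x * ln m) - (real t - x) * ln (1 - m)) * C))" if "m \<in> {0..1}" for m
    using phi_odds[of m x t] that assms by (simp add: pole_def C_def)
  have ln_f: "eln (?f m) = (if pole m then \<infinity> else
      ereal (- (x * ln m) - (real t - x) * ln (1 - m) + ln C))" if "m \<in> {0..1}" for m
    using f[OF that] C by (simp add: eln_ennreal ln_mult)
  have "eln (?f (u * a + v * b)) \<le> ereal u * eln (?f a) + ereal v * eln (?f b)"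
    if ab: "a \<in> {0..1}" "b \<in> {0..1}" and uv: "0 \<le> u" "0 \<le> v" "u + v = 1" for a b u v :: real
  proof -
    \<comment> \<open>Zero weights are split off because zero times infinity is 0 in
      \<open>ereal\<close>, so a pole with weight 0 does not make the right side infinite. The
      combination is then simply one of the two points.\<close>
    consider "u = 0" "v = 1" | "u = 1" "v = 0" | "0 < u" "0 < v"
      using uv by argo
    then show ?thesis
    proof cases
      case 3
      have conv: "u * a + v * b \<in> {0..1}"
        using convexD[OF convex_real_interval(5) ab uv] by simp
      show ?thesis
      proof (cases "pole a \<or> pole b")
        case True
        then show ?thesis
          using 3 by (auto simp: ln_f[OF ab(1)] ln_f[OF ab(2)])
      next
        case False
        have "u * (x * ln a) + v * (x * ln b) \<le> x * ln (u * a + v * b)"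
          using False ab uv 3 assms by (intro mult_ln_concave) (auto simp: pole_def)
        moreover have "u * ((real t - x) * ln (1 - a)) + v * ((real t - x) * ln (1 - b))
            \<le> (real t - x) * ln (1 - (u * a + v * b))"
        proof -
          have "u * ((real t - x) * ln (1 - a)) + v * ((real t - x) * ln (1 - b))
            \<le> (real t - x) * ln (u * (1 - a) + v * (1 - b))"
            using False ab uv 3 assms by (intro mult_ln_concave) (auto simp: pole_def)
          also have "u * (1 - a) + v * (1 - b) = 1 - (u * a + v * b)"
            using uv by (simp add: algebra_simps)
          finally show ?thesis .
        qed
        moreover have "u * ln C + v * ln C = ln C"
          using uv by (simp flip: distrib_right)
        \<comment> \<open>0 and 1 are extreme points of the unit interval: a combination with
          positive weights reaches one of them only if \<open>a\<close> already equals it, and then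
          \<open>a\<close> would be a pole.\<close>
        moreover have "\<not> pole (u * a + v * b)"
        proof
          assume i: "pole (u * a + v * b)"
          have "u * a + v * b = 0 \<Longrightarrow> a = 0"
            using 3 ab by (auto simp: add_nonneg_eq_0_iff)
          moreover have "a = 1" if "u * a + v * b = 1"
          proof -
            have "u * (1 - a) + v * (1 - b) = 0"
              using that uv by (simp add: algebra_simps)
            then show ?thesis
              using 3 ab by (auto simp: add_nonneg_eq_0_iff)
          qed
          ultimately show False
            using i False by (auto simp: pole_def)
        qed
        ultimately show ?thesis
          using False unfolding ln_f[OF ab(1)] ln_f[OF ab(2)] ln_f[OF conv]
          by (simp add: right_diff_distrib distrib_left)
      qed
    qed (auto simp flip: zero_ereal_def one_ereal_def)
  qed
  moreover have "0 < ?f m" if "m \<in> {0..1}" for m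
    using f[OF that] C by simp
  ultimately show ?thesis
    by (auto simp: log_convex_on_def)
qed

text \<open>On the sublevel set the values are positive and finite, so \<open>eln\<close> is a real
  logarithm there. A convex combination of two numbers below \<open>ln c\<close> stays below
  \<open>ln c\<close>.\<close>

lemma log_convex_on_sublevel_convex:
  assumes f: "log_convex_on S f"
  shows "convex {m \<in> S. f m < ennreal c}"
proof (rule convexI)
  fix a b u v :: real
  assume a: "a \<in> {m \<in> S. f m < ennreal c}" and b: "b \<in> {m \<in> S. f m < ennreal c}"
    and uv: "0 \<le> u" "0 \<le> v" "u + v = 1"
  have pos: "0 < f m" if "m \<in> S" for m
    using f that by (simp add: log_convex_on_def)
  have repr: "\<exists>p. f m = ennreal p \<and> 0 < p \<and> p < c" if "m \<in> S" "f m < ennreal c" for m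
    using that(2) pos[OF that(1)]
    by (cases "f m") (auto simp: ennreal_less_iff)
  obtain p where p: "f a = ennreal p" "0 < p" "p < c"
    using repr[of a] a by auto
  obtain q where q: "f b = ennreal q" "0 < q" "q < c"
    using repr[of b] b by auto
  define m where "m = u * a + v * b"
  have m: "m \<in> S"
    using convexD[of S a b u v] f a b uv by (simp add: log_convex_on_def m_def)
  have "eln (f m) \<le> ereal u * eln (f a) + ereal v * eln (f b)"
    using f a b uv by (simp add: log_convex_on_def m_def)
  also have "\<dots> = ereal (u * ln p + v * ln q)"
    using p q by (simp add: eln_ennreal)
  also have "u * ln p + v * ln q < ln c"
    using p q uv by (intro convex_bound_lt) auto
  finally have "eln (f m) < ereal (ln c)"
    by simp
  then have "f m < ennreal c"
    using pos[OF m] p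
    by (cases "f m") (auto simp: eln_ennreal ennreal_less_iff)
  then show "u *\<^sub>R a + v *\<^sub>R b \<in> {m \<in> S. f m < ennreal c}"
    using m by (simp add: m_def)
qed

text \<open>A strict bound on all terms passes to the supremum because the index set is finite. For
  \<open>t = 0\<close> the supremum is the bottom element 0, which lies below
  \<open>1 / \<delta>\<close> as \<open>\<delta>\<close> is positive.\<close>

lemma conf_set_iff:
  assumes "0 < \<delta>"
  shows "m \<in> conf_set t y \<delta> \<longleftrightarrow> m \<in> {0..1} \<and>
    (\<forall>i\<in>{1..t}. phi i (\<Sum>j=1..i. y j) (1 / ennreal m) (1 / ennreal (1 - m)) < ennreal (1 / \<delta>))"
  (is "_ \<longleftrightarrow> _ \<and> (\<forall>i\<in>_. ?f i < _)")
proof -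
  have "(SUP i\<in>{1..t}. ?f i) < ennreal (1 / \<delta>) \<longleftrightarrow> (\<forall>i\<in>{1..t}. ?f i < ennreal (1 / \<delta>))"
  proof (cases "t = 0")
    case False
    then show ?thesis
      using Max_less_iff[of "?f ` {1..t}"] by (simp flip: Max_Sup)
  qed (use assms in \<open>simp add: bot_ennreal\<close>)
  then show ?thesis
    by (simp add: conf_set_def)
qed

section \<open>The confidence set compared with the open interval between its infimum and
  supremum\<close>

lemma conf_set_subset: "conf_set t y \<delta> \<subseteq> {0..1}"
  by (auto simp: conf_set_def)

lemma conf_set_bdd: "bdd_below (conf_set t y \<delta>)" "bdd_above (conf_set t y \<delta>)"
  by (rule bdd_below_mono[OF _ conf_set_subset] bdd_above_mono[OF _ conf_set_subset], simp)+

context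
  fixes t :: nat and y :: "nat \<Rightarrow> real" and \<delta> :: real
  assumes y: "\<forall>i\<in>{1..t}. y i \<in> {0, 1}" and \<delta>: "0 < \<delta>"
begin

lemma convex_conf_set: "convex (conf_set t y \<delta>)"
proof -
  \<comment> \<open>The separate factor \<open>{0..1}\<close> covers \<open>t = 0\<close>, where the
    indexed intersection is the whole line.\<close>
  have "conf_set t y \<delta> = {0..1} \<inter> (\<Inter>i\<in>{1..t}. {m \<in> {0..1}.
    phi i (\<Sum>j=1..i. y j) (1 / ennreal m) (1 / ennreal (1 - m)) < ennreal (1 / \<delta>)})"
    using conf_set_iff[OF \<delta>] by auto
  also have "convex \<dots>"
    by (intro convex_Int convex_INT log_convex_on_sublevel_convex log_convex_on_phi
        partial_sum_bounds[OF y]) auto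
  finally show ?thesis .
qed

text \<open>Inside the unit interval there are no poles, so the set is a finite intersection of
  strict sublevel sets of continuous real functions.\<close>

lemma open_conf_set_interior: "open (conf_set t y \<delta> \<inter> {0<..<1})"
proof -
  define g where "g i m = exp (- ((\<Sum>j=1..i. y j) * ln m) - (real i - (\<Sum>j=1..i. y j)) * ln (1 - m)) *
    (Beta ((\<Sum>j=1..i. y j) + 1/2) (real i - (\<Sum>j=1..i. y j) + 1/2) / Beta (1/2) (1/2))" for i m
  have phi: "phi i (\<Sum>j=1..i. y j) (1 / ennreal m) (1 / ennreal (1 - m)) = ennreal (g i m)"
    "0 \<le> g i m" if "i \<in> {1..t}" "m \<in> {0<..<1}" for i m
  proof -
    have "i \<le> t" using that by simp
    note bounds = partial_sum_bounds[OF y this]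
    have "0 \<le> m" "m \<le> 1" "m \<noteq> 0" "m \<noteq> 1"
      using that by auto
    with phi_odds[OF this(1,2) bounds]
    show "phi i (\<Sum>j=1..i. y j) (1 / ennreal m) (1 / ennreal (1 - m)) = ennreal (g i m)"
      by (simp only: g_def simp_thms if_False)
    show "0 \<le> g i m"
      unfolding g_def by (intro mult_nonneg_nonneg exp_ge_zero less_imp_le[OF Beta_half_pos] bounds)
  qed
  have "conf_set t y \<delta> \<inter> {0<..<1} = {0<..<1} \<inter> (\<Inter>i\<in>{1..t}. {m \<in> {0<..<1}. g i m < 1 / \<delta>})"
    using phi \<delta> by (auto simp: conf_set_iff ennreal_less_iff)
  also have "open \<dots>"
  proof (intro open_Int open_INT ballI)
    fix i
    have "continuous_on {0<..<1} (g i)"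
      unfolding g_def by (intro continuous_intros) auto
    from continuous_open_preimage[OF this open_greaterThanLessThan open_lessThan[of "1 / \<delta>"]]
    show "open {m \<in> {0<..<1}. g i m < 1 / \<delta>}"
      by (simp add: vimage_def Int_def)
  qed auto
  finally show ?thesis .
qed

text \<open>A point strictly between infimum and supremum lies between two members, and convexity
  applies. For an empty confidence set the interval runs from 1 to 0 and is empty as well.\<close>

lemma mu_interval_subset_conf_set: "{mu_low t y \<delta><..<mu_up t y \<delta>} \<subseteq> conf_set t y \<delta>"
proof
  fix m assume m: "m \<in> {mu_low t y \<delta><..<mu_up t y \<delta>}"
  then have ne: "conf_set t y \<delta> \<noteq> {}"
    by (auto simp: mu_low_def mu_up_def)
  with m have "Inf (conf_set t y \<delta>) < m" "m < Sup (conf_set t y \<delta>)"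
    by (auto simp: mu_low_def mu_up_def)
  then obtain a b where "a \<in> conf_set t y \<delta>" "a < m" "b \<in> conf_set t y \<delta>" "m < b"
    using cInf_less_iff[OF ne conf_set_bdd(1)] less_cSup_iff[OF ne conf_set_bdd(2)] by auto
  with convex_conf_set show "m \<in> conf_set t y \<delta>"
    by (meson is_interval_convex_1 is_interval_1 less_imp_le)
qed

lemma conf_set_interior_subset_mu_interval:
  assumes m: "m \<in> conf_set t y \<delta>" "0 < m" "m < 1"
  shows "m \<in> {mu_low t y \<delta><..<mu_up t y \<delta>}"
proof -
  have "m \<in> conf_set t y \<delta> \<inter> {0<..<1}"
    using m by simp
  \<comment> \<open>A closed ball is taken so that \<open>m - e\<close> and \<open>m + e\<close> are
    themselves members; they separate \<open>m\<close> strictly from the infimum and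
    supremum.\<close>
  with open_conf_set_interior obtain e
    where "0 < e" and e: "cball m e \<subseteq> conf_set t y \<delta> \<inter> {0<..<1}"
    unfolding open_contains_cball by metis
  then have "m - e \<in> conf_set t y \<delta>" "m + e \<in> conf_set t y \<delta>"
    by (auto simp: dist_real_def subset_iff)
  then have "Inf (conf_set t y \<delta>) \<le> m - e" "m + e \<le> Sup (conf_set t y \<delta>)"
    by (auto intro: cInf_lower cSup_upper conf_set_bdd)
  with \<open>0 < e\<close> m(1) show ?thesis
    by (auto simp: mu_low_def mu_up_def)
qed

end

section \<open>Uniform tail bound for the wealth and coverage of the confidence sequence\<close>

theorem theorem9:
  fixes M :: "'a measure" and Y :: "nat \<Rightarrow> 'a \<Rightarrow> real" and \<mu> :: real
  assumes "prob_space M"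
    and "\<And>t. 1 \<le> t \<Longrightarrow> Y t \<in> borel_measurable M"
    and "\<And>t \<omega>. 1 \<le> t \<Longrightarrow> \<omega> \<in> space M \<Longrightarrow> Y t \<omega> \<in> {0, 1}"
    and "0 < \<mu>" "\<mu> < 1"
    and "\<And>t. 1 \<le> t \<Longrightarrow> AE \<omega> in M. real_cond_exp M (past M Y t) (Y t) \<omega> = \<mu>"
  shows
    "(\<forall>\<delta>\<in>{0<..1}.
       (let E = {\<omega> \<in> space M. (SUP t\<in>{1..}. phi t (\<Sum>i=1..t. Y i \<omega>)
                   (ennreal (1 / \<mu>)) (ennreal (1 / (1 - \<mu>)))) \<ge> ennreal (1 / \<delta>)}
        in E \<in> sets M \<and> measure M E \<le> \<delta>))
  \<and> (\<forall>t\<ge>1. \<forall>x\<in>{0..real t}.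
       log_convex_on {0..1} (\<lambda>m. phi t x (1 / ennreal m) (1 / ennreal (1 - m))))
  \<and> (\<forall>t\<ge>1. \<forall>\<delta>\<in>{0<..<1}. \<forall>y. (\<forall>i\<in>{1..t}. y i \<in> {0, 1}) \<longrightarrow>
       is_interval (conf_set t y \<delta>) \<and>
       conf_set t y \<delta> \<subseteq> {0..1} \<and>
       {mu_low t y \<delta> <..< mu_up t y \<delta>} \<subseteq> conf_set t y \<delta> \<and>
       conf_set t y \<delta> - {mu_low t y \<delta> <..< mu_up t y \<delta>} \<subseteq> {0, 1})
  \<and> (\<forall>\<delta>\<in>{0<..<1}.
       (let E = {\<omega> \<in> space M. \<exists>t\<ge>1.
                   \<mu> \<notin> {mu_low t (\<lambda>i. Y i \<omega>) \<delta> <..< mu_up t (\<lambda>i. Y i \<omega>) \<delta>}}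
        in E = {\<omega> \<in> space M. \<exists>t\<ge>1. phi t (\<Sum>i=1..t. Y i \<omega>)
                   (ennreal (1 / \<mu>)) (ennreal (1 / (1 - \<mu>))) \<ge> ennreal (1 / \<delta>)} \<and>
           E \<in> sets M \<and> measure M E \<le> \<delta>))"
proof -
  interpret prob_space M by fact
  note meas = assms(2) and bin = assms(3) and \<mu> = assms(4,5) and cexp = assms(6)
  define Z where "Z t \<omega> = phi t (\<Sum>i=1..t. Y i \<omega>) (ennreal (1 / \<mu>)) (ennreal (1 / (1 - \<mu>)))" for t \<omega>
  have bounds: "0 \<le> (\<Sum>i=1..t. Y i \<omega>)" "(\<Sum>i=1..t. Y i \<omega>) \<le> real t"
    if "\<omega> \<in> space M" for t \<omega>
    using partial_sum_bounds[of t "\<lambda>i. Y i \<omega>" t] bin that by auto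
  have Z_mix: "Z t \<omega> = ennreal (beta_mix \<mu> t (\<Sum>i=1..t. Y i \<omega>))" if "\<omega> \<in> space M" for t \<omega>
    unfolding Z_def beta_mix_def
    by (rule phi_ennreal) (use \<mu> bounds[OF that] in auto)
  have odds: "1 / ennreal \<mu> = ennreal (1 / \<mu>)" "1 / ennreal (1 - \<mu>) = ennreal (1 / (1 - \<mu>))"
    using \<mu> divide_ennreal[of 1 \<mu>] divide_ennreal[of 1 "1 - \<mu>"] by simp_all
  have Z_meas: "Z t \<in> borel_measurable M" for t
  proof -
    have "simple_function M (Y i)" if i: "i \<in> {1..t}" for i
      by (rule simple_function_binary) (use i bin meas in auto)
    then have "simple_function M (\<lambda>\<omega>. \<Sum>i=1..t. Y i \<omega>)"
      by (rule simple_function_sum)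
    from simple_function_compose1[OF this] show ?thesis
      unfolding Z_def[abs_def] by (rule borel_measurable_simple_function)
  qed
  define E where "E \<delta> = {\<omega> \<in> space M. ennreal (1 / \<delta>) \<le> (SUP t\<in>{1..}. Z t \<omega>)}" for \<delta>
  have E_sets: "E \<delta> \<in> sets M" for \<delta>
  proof -
    have [measurable]: "(\<lambda>\<omega>. SUP t\<in>{1..}. Z t \<omega>) \<in> borel_measurable M"
      by (intro borel_measurable_SUP Z_meas) auto
    show ?thesis unfolding E_def by measurable
  qed
  have E_prob: "measure M (E \<delta>) \<le> \<delta>" if "0 < \<delta>" for \<delta>
  proof -
    let ?V = "{\<omega> \<in> space M. ennreal (1 / \<delta>) \<le> (SUP t. ennreal (beta_mix \<mu> t (\<Sum>i=1..t. Y i \<omega>)))}"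
    have "E \<delta> \<subseteq> ?V"
    proof
      fix \<omega> assume "\<omega> \<in> E \<delta>"
      then have \<omega>: "\<omega> \<in> space M" "ennreal (1 / \<delta>) \<le> (SUP t\<in>{1..}. Z t \<omega>)"
        by (auto simp: E_def)
      note \<omega>(2)
      \<comment> \<open>Ville's inequality runs from time 0, where the wealth is 1, so the supremum
        is enlarged by that index.\<close>
      also have "(SUP t\<in>{1..}. Z t \<omega>) \<le> (SUP t. Z t \<omega>)"
        by (rule SUP_subset_mono) auto
      finally show "\<omega> \<in> ?V"
        using \<omega>(1) by (simp add: Z_mix)
    qed
    moreover have "?V \<in> sets M"
    proof -
      have [measurable]: "(\<lambda>\<omega>. SUP t. Z t \<omega>) \<in> borel_measurable M"
        by (intro borel_measurable_SUP Z_meas) auto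
      have "{\<omega> \<in> space M. ennreal (1 / \<delta>) \<le> (SUP t. Z t \<omega>)} \<in> sets M"
        by measurable
      also have "{\<omega> \<in> space M. ennreal (1 / \<delta>) \<le> (SUP t. Z t \<omega>)} = ?V"
        by (auto simp: Z_mix)
      finally show ?thesis .
    qed
    ultimately have "measure M (E \<delta>) \<le> measure M ?V"
      by (rule finite_measure_mono)
    also have "\<dots> \<le> 1 / (1 / \<delta>)"
      by (rule beta_mix_ville[OF meas bin \<mu> cexp]) (use that in auto)
    finally show ?thesis by simp
  qed
  \<comment> \<open>Here some single time reaches the threshold, whereas in \<open>E\<close> the
    supremum may do so only in the limit; hence \<open>D\<close> is contained in
    \<open>E\<close>.\<close>
  define D where "D \<delta> = {\<omega> \<in> space M. \<exists>t\<ge>1. ennreal (1 / \<delta>) \<le> Z t \<omega>}" for \<delta>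
  have D_sets: "D \<delta> \<in> sets M" for \<delta>
  proof -
    have [measurable]: "Z t \<in> borel_measurable M" for t
      by (rule Z_meas)
    show ?thesis unfolding D_def by measurable
  qed
  have D_prob: "measure M (D \<delta>) \<le> \<delta>" if "0 < \<delta>" for \<delta>
  proof -
    have "D \<delta> \<subseteq> E \<delta>"
      by (auto simp: D_def E_def intro: order_trans SUP_upper)
    then have "measure M (D \<delta>) \<le> measure M (E \<delta>)"
      using E_sets by (rule finite_measure_mono)
    with E_prob[OF that] show ?thesis by simp
  qed
  \<comment> \<open>The interval and the confidence set can differ only at 0 and 1, and
    \<open>\<mu>\<close> is neither.\<close>
  have cover: "\<mu> \<in> {mu_low t (\<lambda>i. Y i \<omega>) \<delta><..<mu_up t (\<lambda>i. Y i \<omega>) \<delta>} \<longleftrightarrow>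
    (\<forall>i\<in>{1..t}. Z i \<omega> < ennreal (1 / \<delta>))" if "\<omega> \<in> space M" "0 < \<delta>" for t \<omega> \<delta>
  proof -
    have y: "\<forall>i\<in>{1..t}. Y i \<omega> \<in> {0, 1}"
      using bin that(1) by auto
    have "\<mu> \<in> {mu_low t (\<lambda>i. Y i \<omega>) \<delta><..<mu_up t (\<lambda>i. Y i \<omega>) \<delta>} \<longleftrightarrow> \<mu> \<in> conf_set t (\<lambda>i. Y i \<omega>) \<delta>"
      using mu_interval_subset_conf_set[OF y that(2)]
        conf_set_interior_subset_mu_interval[OF y that(2) _ \<mu>] by blast
    also have "\<dots> \<longleftrightarrow> (\<forall>i\<in>{1..t}. Z i \<omega> < ennreal (1 / \<delta>))"
      using \<mu> by (simp add: conf_set_iff[OF that(2)] odds Z_def)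
    finally show ?thesis .
  qed
  have miss: "{\<omega> \<in> space M. \<exists>t\<ge>1. \<mu> \<notin> {mu_low t (\<lambda>i. Y i \<omega>) \<delta><..<mu_up t (\<lambda>i. Y i \<omega>) \<delta>}} = D \<delta>"
    if "0 < \<delta>" for \<delta>
  proof -
    have "(\<exists>t\<ge>1. \<mu> \<notin> {mu_low t (\<lambda>i. Y i \<omega>) \<delta><..<mu_up t (\<lambda>i. Y i \<omega>) \<delta>}) \<longleftrightarrow>
      (\<exists>t\<ge>1. ennreal (1 / \<delta>) \<le> Z t \<omega>)" if \<omega>: "\<omega> \<in> space M" for \<omega>
    proof -
      have "(\<exists>t\<ge>1. \<mu> \<notin> {mu_low t (\<lambda>i. Y i \<omega>) \<delta><..<mu_up t (\<lambda>i. Y i \<omega>) \<delta>}) \<longleftrightarrow>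
        (\<exists>t\<ge>1. \<exists>i\<in>{1..t}. ennreal (1 / \<delta>) \<le> Z i \<omega>)"
        by (simp add: cover[OF \<omega> \<open>0 < \<delta>\<close>] not_less del: greaterThanLessThan_iff)
      \<comment> \<open>A crossing at \<open>i\<close> up to horizon \<open>t\<close> is a crossing
        at time \<open>i\<close>; conversely the horizon is taken to be the crossing time.\<close>
      also have "\<dots> \<longleftrightarrow> (\<exists>t\<ge>1. ennreal (1 / \<delta>) \<le> Z t \<omega>)"
        by (meson atLeastAtMost_iff order_refl)
      finally show ?thesis .
    qed
    then show ?thesis
      unfolding D_def by (intro Collect_cong conj_cong refl)
  qed
  have boundary: "conf_set t y \<delta> - {mu_low t y \<delta><..<mu_up t y \<delta>} \<subseteq> {0, 1}"
    if "\<forall>i\<in>{1..t}. y i \<in> {0, 1}" "0 < \<delta>" for t y \<delta>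
  proof
    fix m assume m: "m \<in> conf_set t y \<delta> - {mu_low t y \<delta><..<mu_up t y \<delta>}"
    then have "\<not> (0 < m \<and> m < 1)"
      using conf_set_interior_subset_mu_interval[OF that] by blast
    with m show "m \<in> {0, 1}"
      by (auto simp: conf_set_def)
  qed
  have a: "E \<delta> \<in> sets M \<and> measure M (E \<delta>) \<le> \<delta>" if "\<delta> \<in> {0<..1}" for \<delta>
    using E_sets E_prob that by simp
  have b: "is_interval (conf_set t y \<delta>) \<and> conf_set t y \<delta> \<subseteq> {0..1} \<and>
      {mu_low t y \<delta><..<mu_up t y \<delta>} \<subseteq> conf_set t y \<delta> \<and>
      conf_set t y \<delta> - {mu_low t y \<delta><..<mu_up t y \<delta>} \<subseteq> {0, 1}"
    if y: "\<forall>i\<in>{1..t}. y i \<in> {0, 1}" and "\<delta> \<in> {0<..<1}" for t y \<delta>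
  proof -
    have \<delta>: "0 < \<delta>" using that by simp
    show ?thesis
      using convex_conf_set[OF y \<delta>] conf_set_subset
        mu_interval_subset_conf_set[OF y \<delta>] boundary[OF y \<delta>]
      by (simp only: is_interval_convex_1 simp_thms)
  qed
  show ?thesis
    unfolding Let_def Z_def[symmetric] E_def[symmetric] D_def[symmetric]
  proof (intro conjI)
    show "\<forall>\<delta>\<in>{0<..1}. E \<delta> \<in> sets M \<and> measure M (E \<delta>) \<le> \<delta>"
      by (intro ballI a)
    show "\<forall>t\<ge>1. \<forall>x\<in>{0..real t}.
      log_convex_on {0..1} (\<lambda>m. phi t x (1 / ennreal m) (1 / ennreal (1 - m)))"
      by (intro allI ballI impI log_convex_on_phi) simp_all
    show "\<forall>t\<ge>1. \<forall>\<delta>\<in>{0<..<1}. \<forall>y. (\<forall>i\<in>{1..t}. y i \<in> {0, 1}) \<longrightarrow>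
      is_interval (conf_set t y \<delta>) \<and> conf_set t y \<delta> \<subseteq> {0..1} \<and>
      {mu_low t y \<delta><..<mu_up t y \<delta>} \<subseteq> conf_set t y \<delta> \<and>
      conf_set t y \<delta> - {mu_low t y \<delta><..<mu_up t y \<delta>} \<subseteq> {0, 1}"
      using b by blast
    show "\<forall>\<delta>\<in>{0<..<1}.
      {\<omega> \<in> space M. \<exists>t\<ge>1. \<mu> \<notin> {mu_low t (\<lambda>i. Y i \<omega>) \<delta><..<mu_up t (\<lambda>i. Y i \<omega>) \<delta>}} = D \<delta> \<and>
      {\<omega> \<in> space M. \<exists>t\<ge>1. \<mu> \<notin> {mu_low t (\<lambda>i. Y i \<omega>) \<delta><..<mu_up t (\<lambda>i. Y i \<omega>) \<delta>}} \<in> sets M \<and>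
      measure M {\<omega> \<in> space M. \<exists>t\<ge>1. \<mu> \<notin> {mu_low t (\<lambda>i. Y i \<omega>) \<delta><..<mu_up t (\<lambda>i. Y i \<omega>) \<delta>}} \<le> \<delta>"
    proof
      fix \<delta> :: real
      assume "\<delta> \<in> {0<..<1}"
      then have \<delta>: "0 < \<delta>" by simp
      show "{\<omega> \<in> space M. \<exists>t\<ge>1. \<mu> \<notin> {mu_low t (\<lambda>i. Y i \<omega>) \<delta><..<mu_up t (\<lambda>i. Y i \<omega>) \<delta>}} = D \<delta> \<and>
        {\<omega> \<in> space M. \<exists>t\<ge>1. \<mu> \<notin> {mu_low t (\<lambda>i. Y i \<omega>) \<delta><..<mu_up t (\<lambda>i. Y i \<omega>) \<delta>}} \<in> sets M \<and>
        measure M {\<omega> \<in> space M. \<exists>t\<ge>1. \<mu> \<notin> {mu_low t (\<lambda>i. Y i \<omega>) \<delta><..<mu_up t (\<lambda>i. Y i \<omega>) \<delta>}} \<le> \<delta>"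
        unfolding miss[OF \<delta>] using D_sets D_prob[OF \<delta>] by (intro conjI refl)
    qed
  qed
qed

end
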